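(* Let $d\in\mathbb{N}$, $\Omega=[0,1]^d$, $\mathbb{V}=L^2(\Omega)$ and $\mathcal{M}\subset\mathbb{V}$. (i) If $\mathcal{M}$ is $p$-convective for some $p\in[1,\infty)$, with associated $2N$-balls $B_{2N}$ ($N\in\mathbb{N}$), then $d(N;\mathcal{M})\gtrsim d(N;B_{2N})$. (ii) If $\mathcal{M}$ is $(\alpha,p)$-sharply convective for some $\alpha>0$ and $p\in[1,\infty)$, then $d(N;\mathcal{M})\gtrsim N^{-\alpha}$. In both parts the implied constant is independent of $N\in\mathbb{N}$.
   Context: The Kolmogorov $N$-width of a set $\mathcal{M}\subset\mathbb{V}$ is $d(N;\mathcal{M})=\inf_{\mathbb{V}_N}\sup_{u\in\mathcal{M}}\inf_{v\in\mathbb{V}_N}\|u-v\|_{\mathbb{V}}$, the first infimum being over all $N$-dimensional subspaces $\mathbb{V}_N$ of $\mathbb{V}$. Notation: $g\lesssim h$ means $g\le C h$ for a constant $C>0$ not depending on the arguments of $g,h$ (here, on $N$); $g\gtrsim h$ means $h\lesssim g$. A set $\mathcal{M}\subset\mathbb{V}$ is said to generate a $2N$-ball ($N\in\mathbb{N}$) if there is a set $B_{2N}=\{\phi_n\}_{n=1}^{2N}$ of linearly independent functions of the form $\phi_n=\sum_{k=1}^\infty a_{nk}u_{nk}$ with $u_{nk}\in\mathcal{M}$, $a_{nk}\in\mathbb{R}$. With such a $B_{2N}$ (and its representation) one associates $A_{N,1}:=\sup_n\sum_{k=1}^\infty|a_{nk}|$ and, for $p\in(1,\infty)$, $A_{N,p}:=\sup_n\big(\sum_{k=1}^\infty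 k^p|a_{nk}|^p\big)^{1/p}$. $B_{2N}$ is called orthogonal if its elements are pairwise orthogonal in $\mathbb{V}$. $\mathcal{M}$ is $p$-convective, $p\in[1,\infty)$, if for every $N\in\mathbb{N}$ it generates a $2N$-ball $B_{2N}$ such that $A_{N,p}\lesssim 1$ for all $N\in\mathbb{N}$; these are the associated $2N$-balls. $\mathcal{M}$ is $(\alpha,p)$-sharply convective if it is $p$-convective and each associated ball $B_{2N}$ itself generates (in the same sense, with $\mathcal{M}$ replaced by $B_{2N}$) an orthogonal $2N$-ball $B'_{2N}=\{\psi_n\}_{n=1}^{2N}$ whose associated number $A'_{N,p}$ satisfies $A'_{N,p}\lesssim1$ and with $\|\psi_n\|_{\mathbb{V}}\gtrsim N^{-\alpha}$ for all $n=1,\dots,2N$ (constants independent of $N$ and $n$). *)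

theory Defs
  imports "HOL-Analysis.Analysis"
begin

section \<open>The real Hilbert space \<open>L\<^sup>2([0,1]\<^sup>d)\<close>\<close>

text \<open>The dimension \<open>d\<close> is the cardinality of the finite index type \<open>'d\<close>, and \<^term>\<open>1 :: real ^ 'd\<close>
  is the all-ones vector, so \<^term>\<open>cbox 0 (1 :: real ^ 'd)\<close> is the cube.\<close>

abbreviation cube_measure :: "(real ^ 'd::finite) measure" where
  "cube_measure \<equiv> lebesgue_on (cbox 0 1)"

lemma cbox_unit_cube: "cbox 0 (1 :: real ^ 'd::finite) = {x. \<forall>i. 0 \<le> x $ i \<and> x $ i \<le> 1}"
  by (auto simp: mem_box_cart)

definition square_integrable :: "(real ^ 'd::finite \<Rightarrow> real) \<Rightarrow> bool" where
  "square_integrable f \<longleftrightarrow>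
     f \<in> borel_measurable cube_measure \<and> integrable cube_measure (\<lambda>x. (f x)\<^sup>2)"

definition l2_rel :: "(real ^ 'd::finite \<Rightarrow> real) \<Rightarrow> (real ^ 'd \<Rightarrow> real) \<Rightarrow> bool" where
  "l2_rel f g \<longleftrightarrow>
     square_integrable f \<and> square_integrable g \<and> (AE x in cube_measure. f x = g x)"

lemma square_integrable_zero: "square_integrable (\<lambda>x. 0)"
  by (simp add: square_integrable_def)

lemma square_integrable_mult:
  assumes "square_integrable f" "square_integrable g"
  shows "integrable cube_measure (\<lambda>x. f x * g x)"
proof (rule Bochner_Integration.integrable_bound)
  show "integrable cube_measure (\<lambda>x. (f x)\<^sup>2 + (g x)\<^sup>2)"
    using assms by (simp add: square_integrable_def)
  show "(\<lambda>x. f x * g x) \<in> borel_measurable cube_measure"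
    using assms by (auto simp: square_integrable_def intro: borel_measurable_times)
  have "\<bar>a * b\<bar> \<le> a\<^sup>2 + b\<^sup>2" for a b :: real
  proof -
    have "0 \<le> (\<bar>a\<bar> - \<bar>b\<bar>)\<^sup>2" by simp
    hence "2 * (\<bar>a\<bar> * \<bar>b\<bar>) \<le> a\<^sup>2 + b\<^sup>2" by (simp add: power2_diff algebra_simps)
    moreover have "0 \<le> \<bar>a\<bar> * \<bar>b\<bar>" by simp
    ultimately show ?thesis unfolding abs_mult by linarith
  qed
  thus "AE x in cube_measure. norm (f x * g x) \<le> norm ((f x)\<^sup>2 + (g x)\<^sup>2)"
    by (intro AE_I2) simp
qed

lemma square_integrable_add:
  assumes "square_integrable f" "square_integrable g"
  shows "square_integrable (\<lambda>x. f x + g x)"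
  using assms square_integrable_mult[OF assms]
  by (auto simp: square_integrable_def power2_sum mult.assoc intro: borel_measurable_add)

lemma square_integrable_scale:
  assumes "square_integrable f"
  shows "square_integrable (\<lambda>x. c * f x)"
  using assms
  by (auto simp: square_integrable_def power_mult_distrib intro: borel_measurable_times)

lemma square_integrable_uminus:
  assumes "square_integrable f"
  shows "square_integrable (\<lambda>x. - f x)"
  using assms by (simp add: square_integrable_def)

lemma square_integrable_diff:
  assumes "square_integrable f" "square_integrable g"
  shows "square_integrable (\<lambda>x. f x - g x)"
  using square_integrable_add[OF assms(1) square_integrable_uminus[OF assms(2)]] by simp

quotient_type 'd l2_cube = "real ^ ('d::finite) \<Rightarrow> real" / partial: l2_rel
proof (rule part_equivpI)
  show "\<exists>f. l2_rel f f"
    using square_integrable_zero by (auto simp: l2_rel_def)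
  show "symp l2_rel"
    by (auto simp: symp_def l2_rel_def)
  show "transp l2_rel"
    unfolding transp_def l2_rel_def by (auto elim: eventually_elim2)
qed

instantiation l2_cube :: (finite) real_vector
begin

lift_definition zero_l2_cube :: "'a l2_cube" is "\<lambda>x. 0"
  by (simp add: l2_rel_def square_integrable_zero)

lift_definition plus_l2_cube :: "'a l2_cube \<Rightarrow> 'a l2_cube \<Rightarrow> 'a l2_cube" is "\<lambda>f g x. f x + g x"
  by (auto simp: l2_rel_def intro: square_integrable_add elim: eventually_elim2)

lift_definition minus_l2_cube :: "'a l2_cube \<Rightarrow> 'a l2_cube \<Rightarrow> 'a l2_cube" is "\<lambda>f g x. f x - g x"
  by (auto simp: l2_rel_def intro: square_integrable_diff elim: eventually_elim2)

lift_definition uminus_l2_cube :: "'a l2_cube \<Rightarrow> 'a l2_cube" is "\<lambda>f x. - f x"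
  by (auto simp: l2_rel_def intro: square_integrable_uminus elim: eventually_mono)

lift_definition scaleR_l2_cube :: "real \<Rightarrow> 'a l2_cube \<Rightarrow> 'a l2_cube" is "\<lambda>c f x. c * f x"
  by (auto simp: l2_rel_def intro: square_integrable_scale elim: eventually_mono)

instance
  by standard
    (transfer; auto simp: l2_rel_def algebra_simps
      intro: square_integrable_add square_integrable_diff square_integrable_scale
        square_integrable_uminus square_integrable_zero)+

end

lemma l2_rel_integral_mult:
  assumes "l2_rel f f'" "l2_rel g g'"
  shows "(\<integral>x. f x * g x \<partial>cube_measure) = (\<integral>x. f' x * g' x \<partial>cube_measure)"
proof (rule integral_cong_AE)
  show "AE x in cube_measure. f x * g x = f' x * g' x"
    using assms by (auto simp: l2_rel_def elim: eventually_elim2)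
qed (use assms in \<open>auto simp: l2_rel_def square_integrable_def\<close>)

instantiation l2_cube :: (finite) real_inner
begin

lift_definition inner_l2_cube :: "'a l2_cube \<Rightarrow> 'a l2_cube \<Rightarrow> real" is
  "\<lambda>f g. \<integral>x. f x * g x \<partial>cube_measure"
  by (rule l2_rel_integral_mult)

definition norm_l2_cube :: "'a l2_cube \<Rightarrow> real" where
  "norm_l2_cube f = sqrt (inner f f)"

definition dist_l2_cube :: "'a l2_cube \<Rightarrow> 'a l2_cube \<Rightarrow> real" where
  "dist_l2_cube f g = norm (f - g)"

definition sgn_l2_cube :: "'a l2_cube \<Rightarrow> 'a l2_cube" where
  "sgn_l2_cube f = f /\<^sub>R norm f"

definition uniformity_l2_cube :: "('a l2_cube \<times> 'a l2_cube) filter" where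
  "uniformity_l2_cube = (INF e\<in>{0<..}. principal {(f, g). dist f g < e})"

definition open_l2_cube :: "'a l2_cube set \<Rightarrow> bool" where
  "open_l2_cube U \<longleftrightarrow> (\<forall>f\<in>U. \<forall>\<^sub>F (f', g) in uniformity. f' = f \<longrightarrow> g \<in> U)"

instance
proof
  fix f g h :: "'a l2_cube" and r :: real
  show "inner f g = inner g f"
    by transfer (simp add: mult.commute)
  show "inner (f + g) h = inner f h + inner g h"
    by transfer (simp add: l2_rel_def distrib_right square_integrable_mult)
  show "inner (r *\<^sub>R f) g = r * inner f g"
    by transfer (simp add: mult.assoc)
  show "0 \<le> inner f f"
    by transfer simp
  show "inner f f = 0 \<longleftrightarrow> f = 0"
  proof transfer
    fix f :: "real ^ 'a \<Rightarrow> real"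
    assume f: "l2_rel f f"
    hence sq: "square_integrable f" by (simp add: l2_rel_def)
    have "(\<integral>x. f x * f x \<partial>cube_measure) = 0 \<longleftrightarrow> (AE x in cube_measure. f x * f x = 0)"
      by (rule integral_nonneg_eq_0_iff_AE) (auto intro: square_integrable_mult sq)
    thus "(\<integral>x. f x * f x \<partial>cube_measure) = 0 \<longleftrightarrow> l2_rel f (\<lambda>x. 0)"
      using sq by (simp add: l2_rel_def square_integrable_zero)
  qed
qed (simp_all add: norm_l2_cube_def dist_l2_cube_def sgn_l2_cube_def
      uniformity_l2_cube_def open_l2_cube_def)

end


section \<open>Kolmogorov widths\<close>

text \<open>\<^const>\<open>dim\<close> also assigns \<open>0\<close> to infinite-dimensional subspaces, hence the explicit finite
  basis.\<close>

definition subspaces_of_dim :: "nat \<Rightarrow> 'a::real_vector set set" where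
  "subspaces_of_dim N = {V. \<exists>B. finite B \<and> card B = N \<and> independent B \<and> V = span B}"

text \<open>The width takes values in \<^typ>\<open>ennreal\<close>, as the supremum is infinite for unbounded sets.\<close>

definition kolmogorov_width :: "nat \<Rightarrow> 'a::real_normed_vector set \<Rightarrow> ennreal" where
  "kolmogorov_width N M =
     (INF V\<in>subspaces_of_dim N. SUP u\<in>M. INF v\<in>V. ennreal (norm (u - v)))"


section \<open>Convective sets\<close>

text \<open>All families are indexed from \<open>1\<close>: only \<open>n \<in> {1..2 * N}\<close> and \<open>k \<ge> 1\<close> matter, and
  \<^term>\<open>\<lambda>k. x (Suc k)\<close> shifts a series starting at \<open>k = 1\<close> to one starting at \<open>0\<close>.
  A ball is carried around with its representation \<open>(a, u)\<close>, on which the numbers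
  \<open>A\<^bsub>N,p\<^esub>\<close> depend; the series converge in norm.\<close>

definition generates_ball ::
  "'a::real_normed_vector set \<Rightarrow> nat \<Rightarrow> (nat \<Rightarrow> 'a) \<Rightarrow> (nat \<Rightarrow> nat \<Rightarrow> real) \<Rightarrow> (nat \<Rightarrow> nat \<Rightarrow> 'a) \<Rightarrow> bool"
where
  "generates_ball M N \<phi> a u \<longleftrightarrow>
     inj_on \<phi> {1..2 * N} \<and> independent (\<phi> ` {1..2 * N}) \<and>
     (\<forall>n\<in>{1..2 * N}.
        (\<forall>k\<ge>1. u n k \<in> M) \<and> (\<lambda>k. a n (Suc k) *\<^sub>R u n (Suc k)) sums \<phi> n)"

definition ennreal_root :: "real \<Rightarrow> ennreal \<Rightarrow> ennreal" where
  "ennreal_root p x = (if x = top then top else ennreal (enn2real x powr (1 / p)))"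

text \<open>The number \<open>A\<^bsub>N,p\<^esub>\<close>. For \<open>p = 1\<close> there is no weight \<open>k\<^sup>p\<close>.\<close>

definition coeff_bound :: "nat \<Rightarrow> real \<Rightarrow> (nat \<Rightarrow> nat \<Rightarrow> real) \<Rightarrow> ennreal" where
  "coeff_bound N p a =
     (if p = 1 then SUP n\<in>{1..2 * N}. \<Sum>k. ennreal \<bar>a n (Suc k)\<bar>
      else SUP n\<in>{1..2 * N}.
        ennreal_root p (\<Sum>k. ennreal (real (Suc k) powr p * \<bar>a n (Suc k)\<bar> powr p)))"

text \<open>\<open>M\<close> is \<open>p\<close>-convective with the associated \<open>2N\<close>-balls \<open>\<phi> N 1, \<dots>, \<phi> N (2N)\<close>, for
  \<open>N = 1, 2, \<dots>\<close>.\<close>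

definition p_convective_with ::
  "real \<Rightarrow> 'a::real_normed_vector set \<Rightarrow> (nat \<Rightarrow> nat \<Rightarrow> 'a) \<Rightarrow>
   (nat \<Rightarrow> nat \<Rightarrow> nat \<Rightarrow> real) \<Rightarrow> (nat \<Rightarrow> nat \<Rightarrow> nat \<Rightarrow> 'a) \<Rightarrow> bool"
where
  "p_convective_with p M \<phi> a u \<longleftrightarrow>
     (\<forall>N\<ge>1. generates_ball M N (\<phi> N) (a N) (u N)) \<and>
     (\<exists>C>0. \<forall>N\<ge>1. coeff_bound N p (a N) \<le> ennreal C)"

definition sharply_convective :: "real \<Rightarrow> real \<Rightarrow> 'a::real_inner set \<Rightarrow> bool" where
  "sharply_convective \<alpha> p M \<longleftrightarrow>
     (\<exists>\<phi> a u. p_convective_with p M \<phi> a u \<and>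
       (\<exists>\<psi> a' u'.
          (\<forall>N\<ge>1. generates_ball (\<phi> N ` {1..2 * N}) N (\<psi> N) (a' N) (u' N) \<and>
                  pairwise orthogonal (\<psi> N ` {1..2 * N})) \<and>
          (\<exists>C>0. \<forall>N\<ge>1. coeff_bound N p (a' N) \<le> ennreal C) \<and>
          (\<exists>c>0. \<forall>N\<ge>1. \<forall>n\<in>{1..2 * N}. c * real N powr (- \<alpha>) \<le> norm (\<psi> N n))))"

end

theory Submission
  imports Defs
begin

text \<open>
  Both parts rest on one comparison principle. The distance to a fixed subspace is a continuous
  seminorm, so if \<open>\<phi> = \<Sum>k. a\<^sub>k u\<^sub>k\<close> with all \<open>u\<^sub>k \<in> M\<close>, then the distance of \<open>\<phi>\<close> to a subspace is
  at most \<open>\<Sum>k. \<bar>a\<^sub>k\<bar>\<close> times the largest distance of a point of \<open>M\<close> to it. Hence a bound on the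
  \<open>\<ell>\<^sup>1\<close>-norms of the coefficients bounds the width of the ball by a multiple of the width of \<open>M\<close>
  (\<open>ball_infdist_le\<close>, \<open>ball_width_le\<close>). The numbers \<open>A\<^bsub>N,p\<^esub>\<close> control these \<open>\<ell>\<^sup>1\<close>-norms: for \<open>p = 1\<close> they are their
  supremum, and for \<open>p > 1\<close> Young's inequality with the conjugate exponent \<open>q\<close> gives
  \<open>\<bar>a\<^sub>k\<bar> = k\<^sup>-\<^sup>1 (k \<bar>a\<^sub>k\<bar>) \<le> (k \<bar>a\<^sub>k\<bar>)\<^sup>p + k\<^sup>-\<^sup>q\<close>, where \<open>\<Sum>k. k\<^sup>-\<^sup>q\<close> converges since \<open>q > 1\<close>
  (\<open>coeff_bound_imp_l1_bound\<close>). This is part (i).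

  For part (ii) the principle is applied twice, from \<open>M\<close> to \<open>B\<^bsub>2N\<^esub>\<close> and from \<open>B\<^bsub>2N\<^esub>\<close> to the
  orthogonal ball. An \<open>N\<close>-dimensional subspace cannot approximate \<open>2N\<close> orthogonal vectors well:
  the squared norms of the projections of the normalised vectors sum to at most \<open>N\<close>, the trace of
  the projection. So for one of the vectors at least half of the squared norm lies outside
  the subspace (\<open>orthogonal_set_far_from_subspace\<close>).
\<close>

section \<open>Distance to a subspace\<close>

lemma infdist_approx:
  assumes "A \<noteq> {}" "0 < e"
  obtains v where "v \<in> A" "dist x v < infdist x A + e"
proof -
  have "bdd_below (dist x ` A)"
    by (intro bdd_belowI[of _ 0]) auto
  then show thesis
    using that assms cINF_less_iff[of A "dist x" "infdist x A + e"] by (auto simp: infdist_notempty)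
qed

lemma infdist_subspace_add:
  assumes "subspace V"
  shows "infdist (x + y) V \<le> infdist x V + infdist (y::'a::real_normed_vector) V"
proof (rule field_le_epsilon)
  fix e :: real assume "0 < e"
  have "V \<noteq> {}" using subspace_0[OF assms] by auto
  obtain v where v: "v \<in> V" "dist x v < infdist x V + e / 2"
    using infdist_approx[OF \<open>V \<noteq> {}\<close>, of "e / 2"] \<open>0 < e\<close> by auto
  obtain w where w: "w \<in> V" "dist y w < infdist y V + e / 2"
    using infdist_approx[OF \<open>V \<noteq> {}\<close>, of "e / 2"] \<open>0 < e\<close> by auto
  have "infdist (x + y) V \<le> dist (x + y) (v + w)"
    by (rule infdist_le) (simp add: subspace_add assms v w)
  also have "\<dots> \<le> dist x v + dist y w" by (rule dist_triangle_add)
  finally show "infdist (x + y) V \<le> infdist x V + infdist y V + e" using v w by linarith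
qed

lemma infdist_subspace_scaleR:
  assumes "subspace V"
  shows "infdist (c *\<^sub>R x) V \<le> \<bar>c\<bar> * infdist (x::'a::real_normed_vector) V"
proof (rule field_le_epsilon)
  fix e :: real assume "0 < e"
  have "V \<noteq> {}" using subspace_0[OF assms] by auto
  define d where "d = e / (\<bar>c\<bar> + 1)"
  have "0 < d" using \<open>0 < e\<close> by (simp add: d_def)
  then obtain v where v: "v \<in> V" "dist x v < infdist x V + d"
    using infdist_approx[OF \<open>V \<noteq> {}\<close>] by blast
  have "infdist (c *\<^sub>R x) V \<le> dist (c *\<^sub>R x) (c *\<^sub>R v)"
    by (rule infdist_le) (simp add: subspace_scale assms v)
  also have "\<dots> = \<bar>c\<bar> * dist x v"
    by (simp add: dist_norm flip: scaleR_diff_right)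
  also have "\<dots> \<le> \<bar>c\<bar> * (infdist x V + d)"
    using v by (intro mult_left_mono) auto
  also have "\<bar>c\<bar> * d \<le> (\<bar>c\<bar> + 1) * d"
    using \<open>0 < d\<close> by simp
  then have "\<bar>c\<bar> * (infdist x V + d) \<le> \<bar>c\<bar> * infdist x V + e"
    by (simp add: d_def distrib_left)
  finally show "infdist (c *\<^sub>R x) V \<le> \<bar>c\<bar> * infdist x V + e" .
qed

text \<open>Partial sums satisfy the bound because the distance to \<open>V\<close> is a seminorm, and the limit
  because the distance is continuous.\<close>

lemma infdist_subspace_sums_le:
  fixes u :: "nat \<Rightarrow> 'a::real_normed_vector"
  assumes V: "subspace V" and D: "\<And>k. infdist (u k) V \<le> D"
    and sums: "(\<lambda>k. b k *\<^sub>R u k) sums x"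
    and b: "\<And>n. (\<Sum>k<n. \<bar>b k\<bar>) \<le> K"
  shows "infdist x V \<le> K * D"
proof -
  have "0 \<le> D" using D[of 0] infdist_nonneg order_trans by blast
  have "infdist (\<Sum>k<n. b k *\<^sub>R u k) V \<le> (\<Sum>k<n. \<bar>b k\<bar>) * D" for n
  proof (induction n)
    case 0
    then show ?case using subspace_0[OF V] by simp
  next
    case (Suc n)
    have "infdist (b n *\<^sub>R u n) V \<le> \<bar>b n\<bar> * D"
      using infdist_subspace_scaleR[OF V] mult_left_mono[OF D, of "\<bar>b n\<bar>" n]
      by (meson abs_ge_zero order_trans)
    then show ?case
      using infdist_subspace_add[OF V, of "\<Sum>k<n. b k *\<^sub>R u k" "b n *\<^sub>R u n"] Suc
      by (simp add: distrib_right)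
  qed
  also have "(\<Sum>k<n. \<bar>b k\<bar>) * D \<le> K * D" for n
    using b \<open>0 \<le> D\<close> by (intro mult_right_mono)
  finally have "infdist (\<Sum>k<n. b k *\<^sub>R u k) V \<le> K * D" for n .
  moreover have "(\<lambda>n. infdist (\<Sum>k<n. b k *\<^sub>R u k) V) \<longlonglongrightarrow> infdist x V"
    using sums unfolding sums_def by (rule tendsto_infdist)
  ultimately show ?thesis
    by (intro LIMSEQ_le_const2) auto
qed

lemma INF_ennreal_norm_eq_infdist:
  fixes x :: "'a::real_normed_vector"
  assumes "V \<noteq> {}"
  shows "(INF v\<in>V. ennreal (norm (x - v))) = ennreal (infdist x V)"
proof (rule antisym)
  show "ennreal (infdist x V) \<le> (INF v\<in>V. ennreal (norm (x - v)))"
    by (intro INF_greatest ennreal_leI) (simp add: infdist_le flip: dist_norm)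
  show "(INF v\<in>V. ennreal (norm (x - v))) \<le> ennreal (infdist x V)"
  proof (rule ennreal_le_epsilon)
    fix e :: real assume "0 < e"
    then obtain v where v: "v \<in> V" "dist x v < infdist x V + e"
      using infdist_approx[OF assms] by blast
    then have "(INF v\<in>V. ennreal (norm (x - v))) \<le> ennreal (infdist x V + e)"
      by (intro INF_lower2[of v] ennreal_leI) (auto simp: dist_norm)
    then show "(INF v\<in>V. ennreal (norm (x - v))) \<le> ennreal (infdist x V) + ennreal e"
      using \<open>0 < e\<close> by (simp add: infdist_nonneg)
  qed
qed

section \<open>Comparison of widths\<close>

text \<open>Only boundedness has to be carried from the weighted \<open>\<ell>\<^sup>p\<close>-norm to the \<open>\<ell>\<^sup>1\<close>-norm, so for
  \<open>p > 1\<close> Young's inequality, applied term by term, does the work of Hoelder's.\<close>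

lemma coeff_bound_imp_l1_bound:
  assumes p: "1 \<le> p" and "0 < C"
  shows "\<exists>K>0. \<forall>N a. coeff_bound N p a \<le> ennreal C \<longrightarrow>
           (\<forall>n\<in>{1..2 * N}. \<forall>m. (\<Sum>k<m. \<bar>a n (Suc k)\<bar>) \<le> K)"
proof -
  have partial: "(\<Sum>k<m. f k) \<le> B"
    if "(\<Sum>k. ennreal (f k)) \<le> ennreal B" "\<And>k. 0 \<le> f k" "0 \<le> B" for f :: "nat \<Rightarrow> real" and m B
  proof -
    have "ennreal (\<Sum>k<m. f k) = (\<Sum>k<m. ennreal (f k))"
      using that(2) by simp
    also have "\<dots> \<le> (\<Sum>k. ennreal (f k))"
      by (rule sum_le_suminf) auto
    also have "\<dots> \<le> ennreal B" by (rule that)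
    finally show ?thesis using that(3) by simp
  qed
  show ?thesis
  proof (cases "p = 1")
    case True
    show ?thesis
    proof (intro exI[of _ C] conjI allI impI ballI)
      fix N a n m
      assume "coeff_bound N p a \<le> ennreal C" "n \<in> {1..2 * N}"
      then have "(\<Sum>k. ennreal \<bar>a n (Suc k)\<bar>) \<le> ennreal C"
        using True by (auto simp: coeff_bound_def SUP_le_iff)
      then show "(\<Sum>k<m. \<bar>a n (Suc k)\<bar>) \<le> C"
        using \<open>0 < C\<close> by (intro partial) auto
    qed (rule \<open>0 < C\<close>)
  next
    case False
    with p have "1 < p" by simp
    define q where "q = p / (p - 1)"
    have "1 < q" and pq: "1 / p + 1 / q = 1"
      using \<open>1 < p\<close> by (auto simp: q_def field_simps)
    define Z where "Z = (\<Sum>k. real (Suc k) powr (- q))"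
    have "summable (\<lambda>k. real k powr (- q))"
      using \<open>1 < q\<close> by (simp add: summable_real_powr_iff)
    then have Z: "summable (\<lambda>k. real (Suc k) powr (- q))"
      by (subst summable_Suc_iff)
    have young: "\<bar>b\<bar> \<le> real (Suc k) powr p * \<bar>b\<bar> powr p + real (Suc k) powr (- q)" for b k
    proof -
      have "\<bar>b\<bar> = (real (Suc k) * \<bar>b\<bar>) * (real (Suc k) powr (-1))"
        by (simp add: powr_minus divide_simps)
      also have "\<dots> \<le> (real (Suc k) * \<bar>b\<bar>) powr p / p + (real (Suc k) powr (-1)) powr q / q"
        by (rule Youngs_inequality) (use \<open>1 < p\<close> \<open>1 < q\<close> pq in auto)
      also have "\<dots> \<le> (real (Suc k) * \<bar>b\<bar>) powr p / 1 + (real (Suc k) powr (-1)) powr q / 1"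
        using \<open>1 < p\<close> \<open>1 < q\<close> by (intro add_mono divide_left_mono) auto
      also have "\<dots> = real (Suc k) powr p * \<bar>b\<bar> powr p + real (Suc k) powr (- q)"
        unfolding powr_powr by (simp add: powr_mult)
      finally show ?thesis .
    qed
    show ?thesis
    proof (intro exI[of _ "C powr p + Z"] conjI allI impI ballI)
      have "0 \<le> Z" unfolding Z_def by (rule suminf_nonneg[OF Z]) simp
      then show "0 < C powr p + Z" using \<open>0 < C\<close> by (simp add: add_pos_nonneg)
      fix N a n m
      assume "coeff_bound N p a \<le> ennreal C" "n \<in> {1..2 * N}"
      then have root: "ennreal_root p (\<Sum>k. ennreal (real (Suc k) powr p * \<bar>a n (Suc k)\<bar> powr p))
          \<le> ennreal C" (is "ennreal_root p ?S \<le> _")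
        using False by (auto simp: coeff_bound_def SUP_le_iff)
      then have "?S \<noteq> top" and le: "enn2real ?S powr (1 / p) \<le> C"
        using \<open>0 < C\<close> by (auto simp: ennreal_root_def top_unique split: if_splits)
      from le have "(enn2real ?S powr (1 / p)) powr p \<le> C powr p"
        using \<open>1 < p\<close> by (intro powr_mono2) auto
      then have "enn2real ?S \<le> C powr p"
        using \<open>1 < p\<close> by (simp add: powr_powr)
      then have "?S \<le> ennreal (C powr p)"
        using \<open>?S \<noteq> top\<close> by (metis ennreal_enn2real ennreal_leI less_top)
      then have S: "(\<Sum>k<m. real (Suc k) powr p * \<bar>a n (Suc k)\<bar> powr p) \<le> C powr p"
        by (intro partial) auto
      have "(\<Sum>k<m. \<bar>a n (Suc k)\<bar>)
          \<le> (\<Sum>k<m. real (Suc k) powr p * \<bar>a n (Suc k)\<bar> powr p + real (Suc k) powr (- q))"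
        by (intro sum_mono young)
      also have "\<dots> = (\<Sum>k<m. real (Suc k) powr p * \<bar>a n (Suc k)\<bar> powr p)
          + (\<Sum>k<m. real (Suc k) powr (- q))"
        by (rule sum.distrib)
      also have "(\<Sum>k<m. real (Suc k) powr (- q)) \<le> Z"
        unfolding Z_def by (rule sum_le_suminf[OF Z]) auto
      finally show "(\<Sum>k<m. \<bar>a n (Suc k)\<bar>) \<le> C powr p + Z" using S by linarith
    qed
  qed
qed

lemma subspaces_of_dim_subspace: "V \<in> subspaces_of_dim N \<Longrightarrow> subspace V"
  by (auto simp: subspaces_of_dim_def)

lemma ball_infdist_le:
  fixes M :: "'a::real_normed_vector set"
  assumes ball: "generates_ball M N \<phi> a u" and V: "subspace V" and "0 < K"
    and K: "\<forall>n\<in>{1..2 * N}. \<forall>m. (\<Sum>k<m. \<bar>a n (Suc k)\<bar>) \<le> K"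
  shows "(SUP x\<in>\<phi> ` {1..2 * N}. ennreal (infdist x V)) \<le> ennreal K * (SUP x\<in>M. ennreal (infdist x V))"
    (is "_ \<le> _ * ?S")
proof (cases "?S = top")
  case True
  show ?thesis unfolding True using \<open>0 < K\<close> by (simp add: ennreal_mult_top)
next
  case False
  define D where "D = enn2real ?S"
  have "0 \<le> D" and S: "?S = ennreal D" using False unfolding D_def by (simp_all only: enn2real_nonneg ennreal_enn2real less_top)
  have "infdist x V \<le> D" if "x \<in> M" for x
    using SUP_upper[OF that, of "\<lambda>x. ennreal (infdist x V)"] \<open>0 \<le> D\<close> by (simp add: S)
  then have "infdist (\<phi> n) V \<le> K * D" if "n \<in> {1..2 * N}" for n
    using ball K that
    by (intro infdist_subspace_sums_le[OF V, of "\<lambda>k. u n (Suc k)" D "\<lambda>k. a n (Suc k)"])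
      (auto simp: generates_ball_def)
  then show ?thesis
    using \<open>0 < K\<close> \<open>0 \<le> D\<close> by (auto simp: S SUP_le_iff simp flip: ennreal_mult intro!: ennreal_leI)
qed

text \<open>The constant depends only on \<open>p\<close> and \<open>C\<close>: this uniformity in the ball makes the implied
  constants independent of \<open>N\<close>, and lets the comparison be iterated along two balls.\<close>

lemma ball_width_le:
  assumes "1 \<le> p" "0 < C"
  shows "\<exists>c>0. \<forall>N L (M :: 'a::real_normed_vector set) \<phi> a u.
    generates_ball M N \<phi> a u \<longrightarrow> coeff_bound N p a \<le> ennreal C \<longrightarrow>
    ennreal c * kolmogorov_width L (\<phi> ` {1..2 * N}) \<le> kolmogorov_width L M"
proof -
  obtain K where "0 < K" and K: "\<And>N a. coeff_bound N p a \<le> ennreal C \<Longrightarrow>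
           \<forall>n\<in>{1..2 * N}. \<forall>m. (\<Sum>k<m. \<bar>a n (Suc k)\<bar>) \<le> K"
    using coeff_bound_imp_l1_bound[OF assms] by blast
  show ?thesis
  proof (intro exI[of _ "1 / K"] conjI allI impI)
    show "0 < 1 / K" using \<open>0 < K\<close> by simp
    fix N L and M :: "'a set" and \<phi> a u
    assume ball: "generates_ball M N \<phi> a u" and a: "coeff_bound N p a \<le> ennreal C"
    show "ennreal (1 / K) * kolmogorov_width L (\<phi> ` {1..2 * N}) \<le> kolmogorov_width L M"
      unfolding kolmogorov_width_def[of L M]
    proof (rule INF_greatest)
      fix V :: "'a set" assume "V \<in> subspaces_of_dim L"
      then have V: "subspace V" "V \<noteq> {}"
        using subspaces_of_dim_subspace subspace_0 by blast+
      have dist: "(INF v\<in>V. ennreal (norm (x - v))) = ennreal (infdist x V)" for x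
        by (rule INF_ennreal_norm_eq_infdist[OF V(2)])
      have "kolmogorov_width L (\<phi> ` {1..2 * N}) \<le> (SUP x\<in>\<phi> ` {1..2 * N}. ennreal (infdist x V))"
        unfolding kolmogorov_width_def dist[symmetric] using \<open>V \<in> _\<close> by (rule INF_lower)
      also have "\<dots> \<le> ennreal K * (SUP x\<in>M. ennreal (infdist x V))"
        by (rule ball_infdist_le[OF ball V(1) \<open>0 < K\<close> K[OF a]])
      finally have "ennreal (1 / K) * kolmogorov_width L (\<phi> ` {1..2 * N})
          \<le> ennreal (1 / K) * (ennreal K * (SUP x\<in>M. ennreal (infdist x V)))"
        by (rule mult_left_mono) simp
      also have "\<dots> = (SUP x\<in>M. ennreal (infdist x V))"
        using \<open>0 < K\<close> by (simp flip: mult.assoc ennreal_mult)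
      finally show "ennreal (1 / K) * kolmogorov_width L (\<phi> ` {1..2 * N})
          \<le> (SUP x\<in>M. INF v\<in>V. ennreal (norm (x - v)))"
        by (simp only: dist)
    qed
  qed
qed

section \<open>Approximation of orthogonal vectors\<close>

text \<open>Pythagoras for the Fourier expansion of \<open>x\<close> along \<open>C\<close>: its residual \<open>r\<close> is orthogonal to
  \<open>span C\<close>. A zero vector in \<open>C\<close> contributes the summand \<open>0 / 0 = 0\<close>.\<close>

lemma orthogonal_expansion_residual:
  fixes C :: "'a::real_inner set"
  assumes "finite C" and C: "pairwise orthogonal C"
  defines "r x \<equiv> x - (\<Sum>b\<in>C. (inner x b / inner b b) *\<^sub>R b)"
  shows "y \<in> span C \<Longrightarrow> inner (r x) y = 0"
    and "inner (r x) (r x) = inner x x - (\<Sum>b\<in>C. (inner x b)\<^sup>2 / inner b b)"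
proof -
  define w where "w = (\<Sum>b\<in>C. (inner x b / inner b b) *\<^sub>R b)"
  have r_eq: "r x = x - w" by (simp add: r_def w_def)
  have rb: "inner (r x) b = 0" if "b \<in> C" for b
  proof -
    have "inner w b = (\<Sum>c\<in>C. inner x c / inner c c * inner c b)"
      by (simp add: w_def inner_sum_left)
    also have "\<dots> = (\<Sum>c\<in>C. if c = b then inner x b / inner b b * inner b b else 0)"
      using C that by (intro sum.cong) (auto simp: pairwise_def orthogonal_def)
    also have "\<dots> = inner x b"
      using \<open>finite C\<close> that by auto
    finally show ?thesis by (simp add: r_eq inner_diff_left)
  qed
  show r: "inner (r x) y = 0" if "y \<in> span C" for y
    using orthogonal_to_span[OF that, of "r x"] rb by (auto simp: orthogonal_def)
  have w: "w \<in> span C" unfolding w_def by (intro span_sum span_scale span_base)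
  have "inner x w = (\<Sum>b\<in>C. (inner x b)\<^sup>2 / inner b b)"
    by (simp add: w_def inner_sum_right power2_eq_square)
  then show "inner (r x) (r x) = inner x x - (\<Sum>b\<in>C. (inner x b)\<^sup>2 / inner b b)"
    using r[OF w] by (simp add: r_eq inner_diff_left inner_diff_right inner_commute)
qed

corollary Bessel_inequality:
  fixes C :: "'a::real_inner set"
  assumes "finite C" "pairwise orthogonal C"
  shows "(\<Sum>b\<in>C. (inner x b)\<^sup>2 / inner b b) \<le> inner x x"
proof -
  have "0 \<le> inner x x - (\<Sum>b\<in>C. (inner x b)\<^sup>2 / inner b b)"
    by (rule order_trans[OF inner_ge_zero orthogonal_expansion_residual(2)[OF assms, THEN eq_refl]])
  then show ?thesis by simp
qed

corollary orthogonal_span_dist_ge: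
  fixes C :: "'a::real_inner set"
  assumes C: "finite C" "pairwise orthogonal C" and v: "v \<in> span C"
  shows "(norm x)\<^sup>2 - (\<Sum>b\<in>C. (inner x b)\<^sup>2 / inner b b) \<le> (norm (x - v))\<^sup>2"
proof -
  define w where "w = (\<Sum>b\<in>C. (inner x b / inner b b) *\<^sub>R b)"
  have "w \<in> span C" unfolding w_def by (intro span_sum span_scale span_base)
  then have orth: "inner (x - w) (w - v) = 0"
    using orthogonal_expansion_residual(1)[OF C span_diff[OF _ v]] by (simp add: w_def)
  have "inner x x - (\<Sum>b\<in>C. (inner x b)\<^sup>2 / inner b b) = inner (x - w) (x - w)"
    using orthogonal_expansion_residual(2)[OF C, of x] by (simp add: w_def)
  also have "\<dots> \<le> inner (x - w) (x - w) + inner (w - v) (w - v)" by simp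
  also have "\<dots> = inner ((x - w) + (w - v)) ((x - w) + (w - v))"
    unfolding inner_add_left inner_add_right using orth by (simp add: inner_commute)
  finally show ?thesis by (simp add: power2_norm_eq_inner)
qed

text \<open>If every \<open>x \<in> S\<close> were close to \<open>V\<close>, then all normalised vectors would have projections of
  squared norm above \<open>card B / card S\<close>, hence of total above \<open>card B\<close>. But exchanging the sums over
  \<open>S\<close> and over an orthogonal basis of \<open>V\<close>, Bessel's inequality with respect to \<open>S\<close> bounds the
  contribution of each basis vector by \<open>1\<close>.\<close>

lemma orthogonal_set_far_from_subspace:
  fixes S :: "'a::real_inner set"
  assumes S: "finite S" "S \<noteq> {}" "pairwise orthogonal S" "0 \<notin> S" and "finite B"
  shows "\<exists>x\<in>S. \<forall>v\<in>span B. (1 - card B / card S) * (norm x)\<^sup>2 \<le> (norm (x - v))\<^sup>2"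
proof (rule ccontr)
  assume contra: "\<not> ?thesis"
  obtain C where C: "finite C" "card C \<le> card B" "span C = span B" "pairwise orthogonal C"
    using basis_orthogonal[OF \<open>finite B\<close>] by blast
  define t where "t x b = (inner x b)\<^sup>2 / (inner x x * inner b b)" for x b :: 'a
  have "card B / card S < (\<Sum>b\<in>C. t x b)" if x: "x \<in> S" for x
  proof -
    obtain v where v: "v \<in> span C" "(norm (x - v))\<^sup>2 < (1 - card B / card S) * (norm x)\<^sup>2"
      using contra x unfolding \<open>span C = span B\<close> by (auto simp: not_le)
    have "0 < inner x x" using x S by (metis inner_gt_zero_iff)
    have "inner x x - (\<Sum>b\<in>C. (inner x b)\<^sup>2 / inner b b) < (1 - card B / card S) * inner x x"
      using orthogonal_span_dist_ge[OF C(1,4) v(1), of x] v(2) by (simp add: power2_norm_eq_inner)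
    then have "card B / card S * inner x x < (\<Sum>b\<in>C. (inner x b)\<^sup>2 / inner b b)"
      by (simp add: left_diff_distrib)
    also have "\<dots> = (\<Sum>b\<in>C. t x b) * inner x x"
      using \<open>0 < inner x x\<close> by (auto simp: t_def sum_distrib_right intro!: sum.cong)
    finally show ?thesis using \<open>0 < inner x x\<close> by (simp only: mult_less_cancel_right_pos)
  qed
  then have "(\<Sum>x\<in>S. card B / card S) < (\<Sum>x\<in>S. \<Sum>b\<in>C. t x b)"
    using S by (intro sum_strict_mono) auto
  moreover have "(\<Sum>x\<in>S. card B / card S) = card B"
    using S by simp
  moreover have "(\<Sum>x\<in>S. \<Sum>b\<in>C. t x b) = (\<Sum>b\<in>C. \<Sum>x\<in>S. t x b)"
    by (rule sum.swap)
  moreover have "(\<Sum>x\<in>S. t x b) \<le> 1" for b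
  proof -
    have "(\<Sum>x\<in>S. t x b) = (\<Sum>x\<in>S. (inner b x)\<^sup>2 / inner x x) / inner b b"
      by (simp add: t_def sum_divide_distrib inner_commute)
    also have "\<dots> \<le> 1"
      using Bessel_inequality[OF S(1,3), of b] by (intro divide_le_eq_1[THEN iffD2]) auto
    finally show ?thesis .
  qed
  then have "(\<Sum>b\<in>C. \<Sum>x\<in>S. t x b) \<le> real (card C)"
    using sum_bounded_above[of C "\<lambda>b. \<Sum>x\<in>S. t x b" 1] by simp
  ultimately show False using C(2) by simp
qed

text \<open>With \<open>2N\<close> vectors against dimension \<open>N\<close> the preceding bound leaves half of the squared norm,
  whence the factor \<open>1 / sqrt 2\<close>.\<close>

lemma orthogonal_width_ge:
  fixes S :: "'a::real_inner set"
  assumes S: "finite S" "pairwise orthogonal S" "card S = 2 * N" and "1 \<le> N" "0 < r"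
    and r: "\<And>x. x \<in> S \<Longrightarrow> r \<le> norm x"
  shows "ennreal (r / sqrt 2) \<le> kolmogorov_width N S"
  unfolding kolmogorov_width_def
proof (rule INF_greatest)
  fix V :: "'a set" assume "V \<in> subspaces_of_dim N"
  then obtain B where B: "finite B" "card B = N" "V = span B"
    by (auto simp: subspaces_of_dim_def)
  have "S \<noteq> {}" "0 \<notin> S" using S(3) \<open>1 \<le> N\<close> \<open>0 < r\<close> r[of 0] by auto
  then obtain x where x: "x \<in> S"
      "\<And>v. v \<in> V \<Longrightarrow> (1 - card B / card S) * (norm x)\<^sup>2 \<le> (norm (x - v))\<^sup>2"
    using orthogonal_set_far_from_subspace[OF S(1) _ S(2) _ B(1)] B(3) by blast
  have "r / sqrt 2 \<le> norm (x - v)" if "v \<in> V" for v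
  proof (rule power2_le_imp_le)
    have "(r / sqrt 2)\<^sup>2 = r\<^sup>2 / 2" by (simp add: power_divide)
    also have "\<dots> \<le> (norm x)\<^sup>2 / 2"
      using r[OF x(1)] \<open>0 < r\<close> by (simp add: power_mono)
    also have "\<dots> \<le> (norm (x - v))\<^sup>2"
      using x(2)[OF that] B(2) S(3) \<open>1 \<le> N\<close> by simp
    finally show "(r / sqrt 2)\<^sup>2 \<le> (norm (x - v))\<^sup>2" .
  qed simp
  then show "ennreal (r / sqrt 2) \<le> (SUP x\<in>S. INF v\<in>V. ennreal (norm (x - v)))"
    by (intro SUP_upper2[OF x(1)] INF_greatest ennreal_leI)
qed

section \<open>Widths of convective sets\<close>

theorem lemma3p4:
  fixes M :: "'d::finite l2_cube set"
  shows "(\<forall>p\<ge>1. \<forall>\<phi> a u. p_convective_with p M \<phi> a u \<longrightarrow>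
            (\<exists>c>0. \<forall>N\<ge>1.
               ennreal c * kolmogorov_width N (\<phi> N ` {1..2 * N}) \<le> kolmogorov_width N M)) \<and>
         (\<forall>\<alpha>>0. \<forall>p\<ge>1. sharply_convective \<alpha> p M \<longrightarrow>
            (\<exists>c>0. \<forall>N\<ge>1. ennreal (c * real N powr (- \<alpha>)) \<le> kolmogorov_width N M))"
proof -
  have width_ge: "\<exists>c>0. \<forall>N\<ge>1.
      ennreal c * kolmogorov_width N (\<phi> N ` {1..2 * N}) \<le> kolmogorov_width N (M N)"
    if p: "1 \<le> p" and balls: "\<forall>N\<ge>1. generates_ball (M N) N (\<phi> N) (a N) (u N)"
      and bounded: "\<exists>C>0. \<forall>N\<ge>1. coeff_bound N p (a N) \<le> ennreal C"
    for p a u \<phi> and M :: "nat \<Rightarrow> 'd l2_cube set"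
  proof -
    obtain C where C: "0 < C" "\<forall>N\<ge>1. coeff_bound N p (a N) \<le> ennreal C"
      using bounded by blast
    obtain c where "0 < c" and c: "\<And>N L (M :: 'd l2_cube set) \<phi> a u.
        generates_ball M N \<phi> a u \<Longrightarrow> coeff_bound N p a \<le> ennreal C \<Longrightarrow>
        ennreal c * kolmogorov_width L (\<phi> ` {1..2 * N}) \<le> kolmogorov_width L M"
      using ball_width_le[OF p C(1), where 'a = "'d l2_cube"] by blast
    show ?thesis
    proof (intro exI[of _ c] conjI allI impI)
      fix N :: nat assume "1 \<le> N"
      then show "ennreal c * kolmogorov_width N (\<phi> N ` {1..2 * N}) \<le> kolmogorov_width N (M N)"
        using balls C(2) by (intro c[of "M N" N "\<phi> N" "a N" "u N"]) auto
    qed (rule \<open>0 < c\<close>)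
  qed
  show ?thesis
  proof (intro conjI allI impI)
    fix p \<phi> a u
    assume "1 \<le> p" "p_convective_with p M \<phi> a u"
    then show "\<exists>c>0. \<forall>N\<ge>1.
        ennreal c * kolmogorov_width N (\<phi> N ` {1..2 * N}) \<le> kolmogorov_width N M"
      by (intro width_ge[of p]) (auto simp: p_convective_with_def)
  next
    fix \<alpha> p :: real
    assume "0 < \<alpha>" "1 \<le> p" "sharply_convective \<alpha> p M"
    then obtain \<phi> a u \<psi> a' u' c where conv: "p_convective_with p M \<phi> a u"
      and gen: "\<forall>N\<ge>1. generates_ball (\<phi> N ` {1..2 * N}) N (\<psi> N) (a' N) (u' N)"
      and orth: "\<forall>N\<ge>1. pairwise orthogonal (\<psi> N ` {1..2 * N})"
      and bound: "\<exists>C>0. \<forall>N\<ge>1. coeff_bound N p (a' N) \<le> ennreal C"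
      and "0 < c" and c: "\<forall>N\<ge>1. \<forall>n\<in>{1..2 * N}. c * real N powr (- \<alpha>) \<le> norm (\<psi> N n)"
      unfolding sharply_convective_def by blast
    obtain c1 where "0 < c1" and c1: "\<And>N. 1 \<le> N \<Longrightarrow>
        ennreal c1 * kolmogorov_width N (\<phi> N ` {1..2 * N}) \<le> kolmogorov_width N M"
      using width_ge[OF \<open>1 \<le> p\<close>, of "\<lambda>_. M" \<phi> a u] conv by (auto simp: p_convective_with_def)
    obtain c2 where "0 < c2" and c2: "\<And>N. 1 \<le> N \<Longrightarrow> ennreal c2 *
        kolmogorov_width N (\<psi> N ` {1..2 * N}) \<le> kolmogorov_width N (\<phi> N ` {1..2 * N})"
      using width_ge[OF \<open>1 \<le> p\<close> gen bound] by blast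
    show "\<exists>c>0. \<forall>N\<ge>1. ennreal (c * real N powr (- \<alpha>)) \<le> kolmogorov_width N M"
    proof (intro exI[of _ "c1 * c2 * c / sqrt 2"] conjI allI impI)
      show "0 < c1 * c2 * c / sqrt 2" using \<open>0 < c1\<close> \<open>0 < c2\<close> \<open>0 < c\<close> by simp
      fix N :: nat assume N: "1 \<le> N"
      have "card (\<psi> N ` {1..2 * N}) = 2 * N"
        using gen N by (auto simp: generates_ball_def card_image)
      then have \<psi>: "ennreal (c * real N powr (- \<alpha>) / sqrt 2) \<le> kolmogorov_width N (\<psi> N ` {1..2 * N})"
        using orth c N \<open>0 < c\<close> by (intro orthogonal_width_ge) auto
      have "ennreal (c1 * c2 * c / sqrt 2 * real N powr (- \<alpha>))
          = ennreal c1 * (ennreal c2 * ennreal (c * real N powr (- \<alpha>) / sqrt 2))"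
        using \<open>0 < c1\<close> \<open>0 < c2\<close> \<open>0 < c\<close> by (simp add: mult_ac flip: ennreal_mult)
      also have "\<dots> \<le> ennreal c1 * (ennreal c2 * kolmogorov_width N (\<psi> N ` {1..2 * N}))"
        by (intro mult_left_mono \<psi>) auto
      also have "\<dots> \<le> ennreal c1 * kolmogorov_width N (\<phi> N ` {1..2 * N})"
        by (intro mult_left_mono c2 N) auto
      also have "\<dots> \<le> kolmogorov_width N M" by (rule c1[OF N])
      finally show "ennreal (c1 * c2 * c / sqrt 2 * real N powr (- \<alpha>)) \<le> kolmogorov_width N M" .
    qed
  qed
qed

end
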